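(* Let $\mathbb{K}$ be a field of characteristic zero, let $n\ge 2$, and let $X_1,\dots,X_n$ be non-commuting variables. Let $\varphi_n(X_1,\dots,X_n)$ be the multilinear part of the degree-$n$ homogeneous component of $\log\big(e^{X_1}e^{X_2}\cdots e^{X_n}\big)$. Then $$\varphi_n(X_1,\dots,X_n)=\frac1n\sum_{\sigma\in S_{n-1}}(-1)^{d_\sigma}\,\frac{1}{\binom{n-1}{d_\sigma}}\,[X_{\sigma(1)},[X_{\sigma(2)},\cdots,[X_{\sigma(n-1)},X_n]\cdots]],$$ where $S_{n-1}$ is the group of permutations of $\{1,\dots,n-1\}$ and $d_\sigma$ is the number of descents of $\sigma$.
   Context: Work in the associative algebra of formal power series over $\mathbb{K}$ in the non-commuting variables $X_1,\dots,X_n$, with $[A,B]=AB-BA$. Here $e^{X}=\sum_{k\ge0}X^k/k!$ and $\log(1+Z)=\sum_{k\ge1}\frac{(-1)^{k-1}}{k}Z^k$ for $Z$ without constant term. Define $\Phi(X_1,\dots,X_n)=\log(e^{X_1}\cdots e^{X_n})=\sum_{m\ge1}\Phi_m(X_1,\dots,X_n)$, where $\Phi_m$ is the homogeneous component of degree $m$. The multilinear part $\varphi_n(X_1,\dots,X_n)$ of $\Phi_n(X_1,\dots,X_n)$ is the sum of those terms of $\Phi_n$ whose monomial contains each variable $X_1,\dots,X_n$ exactly once. For a permutation $\sigma$ of $\{1,\dots,k\}$, a descent is an index $i\in\{1,\dots,k-1\}$ with $\sigma(i)>\sigma(i+1)$, and $d_\sigma$ is the number of descents. *)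

theory Defs
  imports Complex_Main "HOL-Library.Groups_Big_Fun" "HOL-Combinatorics.Permutations"
begin

(* A series in non-commuting variables indexed by 'v is its family of coefficients, indexed by
   words: the word [i1, ..., im] stands for the monomial X_i1 ... X_im, and [] for 1. *)

typedef ('v, 'k) ncps = "UNIV :: ('v list \<Rightarrow> 'k) set"
  morphisms coeff Abs_ncps
  by simp

lemma coeff_Abs_ncps [simp]: "coeff (Abs_ncps f) = f"
  by (simp add: Abs_ncps_inverse)

lemma ncps_eqI: "(\<And>w. coeff A w = coeff B w) \<Longrightarrow> A = B"
  by (simp add: coeff_inject[symmetric] fun_eq_iff)

lemma ncps_eq_iff: "A = B \<longleftrightarrow> (\<forall>w. coeff A w = coeff B w)"
  by (auto intro: ncps_eqI)

instantiation ncps :: (type, ring_1) ring_1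
begin

definition "0 = Abs_ncps (\<lambda>w. 0)"
definition "1 = Abs_ncps (\<lambda>w. if w = [] then 1 else 0)"
definition "A + B = Abs_ncps (\<lambda>w. coeff A w + coeff B w)"
definition "A - B = Abs_ncps (\<lambda>w. coeff A w - coeff B w)"
definition "- A = Abs_ncps (\<lambda>w. - coeff A w)"
definition "A * B = Abs_ncps (\<lambda>w. \<Sum>i\<le>length w. coeff A (take i w) * coeff B (drop i w))"

lemma coeff_0 [simp]: "coeff (0 :: ('a, 'b) ncps) w = 0"
  and coeff_1: "coeff (1 :: ('a, 'b) ncps) w = (if w = [] then 1 else 0)"
  and coeff_add [simp]: "coeff (A + B) w = coeff A w + coeff B w"
  and coeff_diff [simp]: "coeff (A - B) w = coeff A w - coeff B w"
  and coeff_uminus [simp]: "coeff (- A) w = - coeff A w"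
  and coeff_mult: "coeff (A * B) w = (\<Sum>i\<le>length w. coeff A (take i w) * coeff B (drop i w))"
  for A B :: "('a, 'b) ncps"
  by (simp_all add: zero_ncps_def one_ncps_def plus_ncps_def minus_ncps_def uminus_ncps_def
      times_ncps_def)

instance
proof
  fix A B C :: "('a, 'b) ncps"
  show "A + B + C = A + (B + C)" "A + B = B + A" "0 + A = A" "- A + A = 0" "A - B = A + - B"
    by (simp_all add: ncps_eq_iff add_ac)
  show "(0::('a, 'b) ncps) \<noteq> 1"
    by (auto simp: ncps_eq_iff coeff_1 intro: exI[of _ "[]"])
  show "(A + B) * C = A * C + B * C" "A * (B + C) = A * B + A * C"
    by (simp_all add: ncps_eq_iff coeff_mult sum.distrib distrib_left distrib_right)
  show "1 * A = A"
  proof (rule ncps_eqI)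
    fix w
    have "coeff (1 * A) w = (\<Sum>i\<le>length w. if i = 0 then coeff A w else 0)"
      unfolding coeff_mult by (intro sum.cong) (auto simp: coeff_1)
    then show "coeff (1 * A) w = coeff A w" by simp
  qed
  show "A * 1 = A"
  proof (rule ncps_eqI)
    fix w
    have "coeff (A * 1) w = (\<Sum>i\<le>length w. if i = length w then coeff A w else 0)"
      unfolding coeff_mult by (intro sum.cong) (auto simp: coeff_1)
    then show "coeff (A * 1) w = coeff A w" by simp
  qed
  show "A * B * C = A * (B * C)"
  proof (rule ncps_eqI)
    fix w
    have "coeff (A * B * C) w =
        (\<Sum>i\<le>length w. coeff (A * B) (take i w) * coeff C (drop i w))"
      by (simp only: coeff_mult)
    also have "\<dots> = (\<Sum>i\<le>length w. \<Sum>j\<le>i.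
        coeff A (take j w) * coeff B (drop j (take i w)) * coeff C (drop i w))"
      by (intro sum.cong) (auto simp: coeff_mult sum_distrib_right min_absorb1 min_absorb2 intro!: sum.cong)
    also have "\<dots> = (\<Sum>(i, j)\<in>(SIGMA i:{..length w}. {..i}).
        coeff A (take j w) * coeff B (drop j (take i w)) * coeff C (drop i w))"
      by (simp add: sum.Sigma)
    also have "\<dots> = (\<Sum>(j, k)\<in>(SIGMA j:{..length w}. {..length w - j}).
        coeff A (take j w) * (coeff B (take k (drop j w)) * coeff C (drop k (drop j w))))"
      by (rule sum.reindex_bij_witness[where i = "\<lambda>(j, k). (j + k, j)"
            and j = "\<lambda>(i, j). (j, i - j)"])
         (auto simp: drop_take mult.assoc)
    also have "\<dots> = coeff (A * (B * C)) w"
      by (simp add: coeff_mult sum_distrib_left sum.Sigma)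
    finally show "coeff (A * B * C) w = coeff (A * (B * C)) w" .
  qed
qed

end

definition nc_var :: "'v \<Rightarrow> ('v, 'k::ring_1) ncps" where
  "nc_var i = Abs_ncps (\<lambda>w. if w = [i] then 1 else 0)"

definition nc_scale :: "'k::ring_1 \<Rightarrow> ('v, 'k) ncps \<Rightarrow> ('v, 'k) ncps" where
  "nc_scale c A = Abs_ncps (\<lambda>w. c * coeff A w)"

(* Sum of a locally finite family: every word has a nonzero coefficient in only finitely many
   f k.  For other families the value is junk (Sum_any is 0 on infinite support). *)
definition nc_suminf :: "(nat \<Rightarrow> ('v, 'k::ring_1) ncps) \<Rightarrow> ('v, 'k) ncps" where
  "nc_suminf f = Abs_ncps (\<lambda>w. Sum_any (\<lambda>k. coeff (f k) w))"

definition nc_exp :: "('v, 'k::field_char_0) ncps \<Rightarrow> ('v, 'k) ncps" where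
  "nc_exp A = nc_suminf (\<lambda>k. nc_scale (1 / fact k) (A ^ k))"

(* log (1 + Z) with Z = A - 1; the summation index k \<ge> 1 of the usual series is Suc k here. *)
definition nc_log :: "('v, 'k::field_char_0) ncps \<Rightarrow> ('v, 'k) ncps" where
  "nc_log A = nc_suminf (\<lambda>k. nc_scale ((-1) ^ k / of_nat (Suc k)) ((A - 1) ^ Suc k))"

definition nc_comm :: "('v, 'k::ring_1) ncps \<Rightarrow> ('v, 'k) ncps \<Rightarrow> ('v, 'k) ncps" where
  "nc_comm A B = A * B - B * A"

definition homogeneous_part :: "nat \<Rightarrow> ('v, 'k::ring_1) ncps \<Rightarrow> ('v, 'k) ncps" where
  "homogeneous_part m A = Abs_ncps (\<lambda>w. if length w = m then coeff A w else 0)"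

definition multilinear_part :: "'v set \<Rightarrow> ('v, 'k::ring_1) ncps \<Rightarrow> ('v, 'k) ncps" where
  "multilinear_part V A = Abs_ncps (\<lambda>w. if \<forall>i\<in>V. count_list w i = 1 then coeff A w else 0)"

definition Phi :: "nat \<Rightarrow> (nat, 'k::field_char_0) ncps" where
  "Phi n = nc_log (prod_list (map (\<lambda>i. nc_exp (nc_var i)) [1..<Suc n]))"

definition phi :: "nat \<Rightarrow> (nat, 'k::field_char_0) ncps" where
  "phi n = multilinear_part {1..n} (homogeneous_part n (Phi n))"

definition descents :: "nat \<Rightarrow> (nat \<Rightarrow> nat) \<Rightarrow> nat" where
  "descents k \<sigma> = card {i \<in> {1..<k}. \<sigma> i > \<sigma> (Suc i)}"

definition nested_comm :: "nat \<Rightarrow> (nat \<Rightarrow> nat) \<Rightarrow> (nat, 'k::ring_1) ncps" where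
  "nested_comm n \<sigma> = foldr (\<lambda>i. nc_comm (nc_var (\<sigma> i))) [1..<n] (nc_var n)"

(* The families in nc_exp and nc_log are locally finite when A, respectively A - 1, has no
   constant term. *)
lemma coeff_power_eq_0:
  assumes "coeff Z [] = 0" "length w < k"
  shows "coeff (Z ^ k) w = 0"
  using assms(2)
proof (induction k arbitrary: w)
  case (Suc k)
  show ?case
    unfolding power_Suc coeff_mult
  proof (intro sum.neutral ballI)
    fix i assume i: "i \<in> {..length w}"
    show "coeff Z (take i w) * coeff (Z ^ k) (drop i w) = 0"
    proof (cases "i = 0")
      case True
      then show ?thesis by (simp add: assms(1))
    next
      case False
      then have "length (drop i w) < k" using Suc.prems i by auto
      then show ?thesis by (simp add: Suc.IH)
    qed
  qed
qed simp

lemma coeff_nc_suminf_power: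
  assumes "coeff Z [] = 0"
  shows "coeff (nc_suminf (\<lambda>k. nc_scale (c k) (Z ^ k))) w = (\<Sum>k\<le>length w. c k * coeff (Z ^ k) w)"
  unfolding nc_suminf_def nc_scale_def coeff_Abs_ncps
  by (rule Sum_any.expand_superset)
     (auto simp: assms coeff_power_eq_0 not_less[symmetric])

end

(* A product A of exponentials of variables is a character of the shuffle algebra, and so is every
   power of A; hence f = coeff (log A) vanishes on shuffles of nonempty words, which gives
   f (u n v) = (-1)^|v| sum of f (s n) over the shuffles s of u and rev v.  In the sum over s of
   f (s n) [X_s(1), [..., X_n]] the coefficient at u n v is that same sum, because each X_s(i) moves
   either to the left of X_n, in order, or to the right, reversed and with a sign.  So only f (s n)
   has to be computed: with d descents among n letters, cutting into increasing blocks gives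
   sum_j (-1)^(d+j) binom(n-1-d, j) / (d+j+1), a Beta integral. *)

theory Submission
  imports "HOL-Computational_Algebra.Polynomial" "HOL-Combinatorics.Multiset_Permutations" Defs
begin

hide_const (open) Polynomial.coeff

section \<open>Sums over shuffles\<close>

text \<open>This is \<open>g\<close>, extended linearly, at the shuffle product of the two words,
  with multiplicity. The recursion picks the first letter and absorbs it into \<open>g\<close>, so
  no multiset of shuffles is built.\<close>

fun shuffle_sum :: "('v list \<Rightarrow> 'a::comm_monoid_add) \<Rightarrow> 'v list \<Rightarrow> 'v list \<Rightarrow> 'a" where
  "shuffle_sum g [] v = g v"
| "shuffle_sum g (a # u) [] = g (a # u)"
| "shuffle_sum g (a # u) (b # v) =
     shuffle_sum (\<lambda>w. g (a # w)) u (b # v) + shuffle_sum (\<lambda>w. g (b # w)) (a # u) v"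

lemma shuffle_sum_Nil2 [simp]: "shuffle_sum g u [] = g u"
  by (cases u) auto

text \<open>Used to evaluate polynomial-valued shuffle sums at a point, and to differentiate them,
  term by term.\<close>

lemma shuffle_sum_hom:
  assumes "\<And>x y. h (x + y) = h x + h y"
  shows "shuffle_sum (\<lambda>w. h (g w)) u v = h (shuffle_sum g u v)"
  by (induction g u v rule: shuffle_sum.induct) (auto simp: assms)

lemma shuffle_sum_add:
  "shuffle_sum (\<lambda>w. g w + h w) u v = shuffle_sum g u v + shuffle_sum h u v"
proof (induction g u v arbitrary: h rule: shuffle_sum.induct)
  case (3 g a u b v)
  show ?case
    by (simp only: shuffle_sum.simps "3.IH") (simp add: add_ac)
qed auto

lemma shuffle_sum_mult_left:
  fixes c :: "'a::semiring_0"
  shows "shuffle_sum (\<lambda>w. c * g w) u v = c * shuffle_sum g u v"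
  by (rule shuffle_sum_hom) (simp add: distrib_left)

lemma shuffle_sum_0 [simp]: "shuffle_sum (\<lambda>w. 0) u v = 0"
  by (induction "\<lambda>w::'b list. 0::'a" u v rule: shuffle_sum.induct) auto

text \<open>The defining recursion, read from the right end; the reversal argument below splits
  shuffles by their last letter.\<close>

lemma shuffle_sum_snoc:
  "shuffle_sum g (u @ [a]) (v @ [b]) =
     shuffle_sum (\<lambda>w. g (w @ [a])) u (v @ [b]) + shuffle_sum (\<lambda>w. g (w @ [b])) (u @ [a]) v"
proof (induction g u v rule: shuffle_sum.induct)
  case (1 g v)
  show ?case
  proof (induction v arbitrary: g)
    case (Cons c v)
    then show ?case by (simp add: add_ac)
  qed (simp add: add_ac)
next
  case (2 g c u)
  have "shuffle_sum g (u @ [a]) [b] = g (u @ [a, b]) + shuffle_sum (\<lambda>w. g (w @ [a])) u [b]" for g u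
    by (induction u arbitrary: g) (auto simp: add_ac)
  from this[of g "c # u"] show ?case by (simp add: add_ac)
next
  case (3 g c u d v)
  then show ?case by (simp add: add_ac)
qed

lemma shuffle_sum_zero_imp_reverse:
  fixes g :: "'v list \<Rightarrow> 'a::ring_1"
  assumes "\<And>u v. u \<noteq> [] \<Longrightarrow> v \<noteq> [] \<Longrightarrow> shuffle_sum g u v = 0"
  shows "g (u @ a # v) = (-1) ^ length v * shuffle_sum (\<lambda>w. g (w @ [a])) u (rev v)"
proof (induction v arbitrary: u a)
  case (Cons y v)
  \<comment> \<open>The shuffles of \<open>u @ [a]\<close> and \<open>rev v @ [y]\<close> end in
    \<open>a\<close> or in \<open>y\<close>. Since their total vanishes, exchanging the two kinds of
    ending costs a sign, and \<open>y\<close> passes to the other side of \<open>a\<close>.\<close>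
  have "shuffle_sum (\<lambda>w. g (w @ [a])) u (rev v @ [y]) +
      shuffle_sum (\<lambda>w. g (w @ [y])) (u @ [a]) (rev v) = 0"
    using assms[of "u @ [a]" "rev v @ [y]"] by (simp add: shuffle_sum_snoc)
  then have "shuffle_sum (\<lambda>w. g (w @ [y])) (u @ [a]) (rev v) =
      - shuffle_sum (\<lambda>w. g (w @ [a])) u (rev v @ [y])"
    by (simp add: eq_neg_iff_add_eq_0 add.commute)
  then show ?case using Cons.IH[of "u @ [a]" y] by simp
qed simp

text \<open>The product of series, on bare coefficient functions: peeling off a first letter
  replaces \<open>g\<close> by its restriction to words starting with that letter.\<close>

definition conv :: "('v list \<Rightarrow> 'a::comm_semiring_1) \<Rightarrow> ('v list \<Rightarrow> 'a) \<Rightarrow> 'v list \<Rightarrow> 'a" where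
  "conv g h w = (\<Sum>i\<le>length w. g (take i w) * h (drop i w))"

lemma conv_Nil [simp]: "conv g h [] = g [] * h []"
  by (simp add: conv_def)

lemma conv_Cons: "conv g h (a # w) = g [] * h (a # w) + conv (\<lambda>w. g (a # w)) h w"
  by (simp add: conv_def sum.atMost_Suc_shift del: sum.atMost_Suc)

text \<open>Deconcatenation is multiplicative for the shuffle product: cutting a shuffle of
  \<open>u\<close> and \<open>v\<close> in two gives a shuffle of two prefixes and a shuffle of the
  two remaining suffixes.\<close>

lemma shuffle_sum_conv:
  "shuffle_sum (conv g h) u v = (\<Sum>i\<le>length u. \<Sum>j\<le>length v.
     shuffle_sum g (take i u) (take j v) * shuffle_sum h (drop i u) (drop j v))"
proof (induction "length u + length v" arbitrary: g h u v rule: less_induct)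
  case less
  show ?case
  proof (cases "u = [] \<or> v = []")
    case True
    then show ?thesis by (auto simp: conv_def)
  next
    case False
    then obtain a u' b v' where uv: "u = a # u'" "v = b # v'"
      by (metis neq_Nil_conv)
    let ?ga = "\<lambda>w. g (a # w)" and ?gb = "\<lambda>w. g (b # w)"
    let ?S = "\<lambda>g u v. \<Sum>i\<le>length u. \<Sum>j\<le>length v.
      shuffle_sum g (take i u) (take j v) * shuffle_sum h (drop i u) (drop j v)"
    have "shuffle_sum (conv g h) (a # u') (b # v') =
        g [] * shuffle_sum h (a # u') (b # v') + shuffle_sum (conv ?ga h) u' (b # v')
          + shuffle_sum (conv ?gb h) (a # u') v'"
      by (simp add: conv_Cons shuffle_sum_add shuffle_sum_mult_left algebra_simps)
    also have "shuffle_sum (conv ?ga h) u' (b # v') = ?S ?ga u' (b # v')"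
      by (rule less) (simp add: uv)
    also have "shuffle_sum (conv ?gb h) (a # u') v' = ?S ?gb (a # u') v'"
      by (rule less) (simp add: uv)
    also have "g [] * shuffle_sum h (a # u') (b # v') + ?S ?ga u' (b # v') + ?S ?gb (a # u') v' =
        ?S g (a # u') (b # v')"
      by (simp add: sum.atMost_Suc_shift sum.distrib algebra_simps del: sum.atMost_Suc)
    finally show ?thesis by (simp add: uv)
  qed
qed


section \<open>Characters of the shuffle algebra\<close>

text \<open>These are the coefficient functions of group-like series, except that the value at
  \<open>[]\<close> is only forced to be idempotent; \<open>coeff A [] = 1\<close> is a separate
  assumption for the logarithm.\<close>

definition character :: "('v list \<Rightarrow> 'a::comm_ring_1) \<Rightarrow> bool" where
  "character g \<longleftrightarrow> (\<forall>u v. shuffle_sum g u v = g u * g v)"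

lemma coeff_mult_conv: "coeff (A * B) = conv (coeff A) (coeff B)"
  by (simp add: fun_eq_iff coeff_mult conv_def)

lemma character_mult:
  assumes "character (coeff A)" "character (coeff B)"
  shows "character (coeff (A * B))"
  using assms unfolding character_def coeff_mult_conv shuffle_sum_conv
  by (simp add: conv_def sum_product mult_ac)

lemma character_1: "character (coeff 1)"
  unfolding character_def
proof (intro allI)
  fix u v :: "'a list"
  show "shuffle_sum (coeff 1) u v = coeff 1 u * (coeff 1 v :: 'b)"
    by (cases "(coeff 1 :: 'a list \<Rightarrow> 'b, u, v)" rule: shuffle_sum.cases) (auto simp: coeff_1)
qed

lemma character_power: "character (coeff A) \<Longrightarrow> character (coeff (A ^ N))"
  by (induction N) (auto intro: character_1 character_mult)

lemma character_prod_list: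
  "(\<And>A. A \<in> set As \<Longrightarrow> character (coeff A)) \<Longrightarrow> character (coeff (prod_list As))"
  by (induction As) (auto intro: character_1 character_mult)

section \<open>Exponentials of single variables\<close>

lemma coeff_nc_var: "coeff (nc_var i) w = (if w = [i] then 1 else 0)"
  by (simp add: nc_var_def)

lemma coeff_nc_scale [simp]: "coeff (nc_scale c A) w = c * coeff A w"
  by (simp add: nc_scale_def)

lemma conv_single: "conv (\<lambda>w. if w = [] then c else 0) h w = c * h w"
proof (cases w)
  case (Cons a w')
  have "conv (\<lambda>w. 0) h w' = 0" by (simp add: conv_def)
  then show ?thesis by (simp add: Cons conv_Cons)
qed simp

lemma coeff_nc_var_mult:
  fixes B :: "('v, 'k::comm_ring_1) ncps"
  shows "coeff (nc_var i * B) w = (case w of [] \<Rightarrow> 0 | x # w' \<Rightarrow> if x = i then coeff B w' else 0)"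
proof (cases w)
  case (Cons x w')
  have "coeff (nc_var i * B) w = conv (\<lambda>w. if w = [] then (if x = i then 1 else 0) else 0) (coeff B) w'"
    unfolding Cons coeff_mult_conv conv_Cons by (simp add: coeff_nc_var conv_def cong: if_cong)
  then show ?thesis by (simp add: conv_single Cons)
qed (simp add: coeff_mult coeff_nc_var)

lemma coeff_nc_var_power:
  "coeff (nc_var i ^ k) w = (if w = replicate k i then 1 else (0 :: 'k::comm_ring_1))"
  by (induction k arbitrary: w) (auto simp: coeff_nc_var_mult coeff_1 split: list.split)

lemma coeff_nc_exp_nc_var:
  "coeff (nc_exp (nc_var i)) w = (if set w \<subseteq> {i} then 1 / fact (length w) else 0)"
proof -
  have "coeff (nc_exp (nc_var i)) w =
      (\<Sum>k\<le>length w. 1 / fact k * coeff (nc_var i ^ k) w)"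
    unfolding nc_exp_def by (rule coeff_nc_suminf_power) (simp add: coeff_nc_var)
  also have "\<dots> = (\<Sum>k\<le>length w. if k = length w then
      (if w = replicate (length w) i then 1 / fact (length w) else 0) else 0)"
    by (rule sum.cong) (auto simp: coeff_nc_var_power)
  also have "w = replicate (length w) i \<longleftrightarrow> set w \<subseteq> {i}"
    by (induction w) auto
  finally show ?thesis by simp
qed

text \<open>All binom(|u|+|v|, |u|) shuffles of two powers of one letter are the same word; the
  induction is Pascal's rule. \<open>c\<close> must vary, since removing a letter shifts its
  argument.\<close>

lemma shuffle_sum_uniform:
  assumes "\<And>w. g w = (if set w \<subseteq> {i} then c (length w) else 0)"
  shows "shuffle_sum g u v = (if set u \<subseteq> {i} \<and> set v \<subseteq> {i}
    then of_nat ((length u + length v) choose length u) * c (length u + length v) else 0)"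
  using assms
proof (induction g u v arbitrary: c rule: shuffle_sum.induct)
  case (3 g a u b v)
  have 1: "shuffle_sum (\<lambda>w. g (a # w)) u (b # v) =
     (if set u \<subseteq> {i} \<and> set (b # v) \<subseteq> {i} then of_nat ((length u + length (b # v)) choose length u) *
       (if a = i then c (Suc (length u + length (b # v))) else 0) else 0)"
    by (rule 3) (simp add: 3)
  have 2: "shuffle_sum (\<lambda>w. g (b # w)) (a # u) v =
     (if set (a # u) \<subseteq> {i} \<and> set v \<subseteq> {i} then of_nat ((length (a # u) + length v) choose length (a # u)) *
       (if b = i then c (Suc (length (a # u) + length v)) else 0) else 0)"
    by (rule 3) (simp add: 3)
  show ?case by (simp add: 1 2 algebra_simps)
qed auto

lemma character_nc_exp_nc_var: "character (coeff (nc_exp (nc_var i)))"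
  unfolding character_def
proof (intro allI)
  fix u v :: "'a list"
  have "of_nat ((length u + length v) choose length u) / fact (length u + length v) =
      (1 / (fact (length u) * fact (length v)) :: 'b)"
    using binomial_fact[of "length u" "length u + length v", where 'a = 'b] by simp
  then show "shuffle_sum (coeff (nc_exp (nc_var i))) u v =
      coeff (nc_exp (nc_var i)) u * (coeff (nc_exp (nc_var i)) v :: 'b)"
    by (subst shuffle_sum_uniform[where i = i and c = "\<lambda>n. 1 / fact n"])
       (auto simp: coeff_nc_exp_nc_var)
qed

section \<open>The logarithm of a character\<close>

fun binomial_poly :: "nat \<Rightarrow> 'k::field_char_0 poly" where
  "binomial_poly 0 = 1"
| "binomial_poly (Suc k) = binomial_poly k * [: - of_nat k / of_nat (Suc k), 1 / of_nat (Suc k) :]"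

lemma poly_binomial_poly: "poly (binomial_poly k) (of_nat N) = of_nat (N choose k)"
proof (induction k)
  case (Suc k)
  have "of_nat (Suc k) * of_nat (N choose Suc k) = of_nat (N choose k) * (of_nat N - of_nat k :: 'a)"
  proof (cases "k \<le> N")
    case True
    then have "Suc k * (N choose Suc k) = (N choose k) * (N - k)"
      by (simp only: binomial_absorption binomial_absorb_comp mult.commute[of "N choose k"])
    then show ?thesis
      using True by (metis of_nat_diff of_nat_mult)
  qed (simp add: binomial_eq_0)
  then show ?case
    by (simp add: Suc field_simps del: of_nat_Suc)
qed simp

lemma poly_binomial_poly_0: "poly (binomial_poly k) 0 = (if k = 0 then 1 else 0)"
  using poly_binomial_poly[of k 0] by (cases k) auto

text \<open>These are the coefficients of the logarithm series: log(1 + Z) is the derivative at N =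
  0 of (1 + Z)^N, the sum of binom(N, k) Z^k. By the product rule only the derivative of the
  previous polynomial survives at 0.\<close>

lemma poly_pderiv_binomial_poly_Suc_0:
  "poly (pderiv (binomial_poly (Suc k))) 0 = (-1) ^ k / of_nat (Suc k)"
proof (induction k)
  case (Suc k)
  have "poly (pderiv (binomial_poly (Suc (Suc k)))) 0 =
      - of_nat (Suc k) / of_nat (Suc (Suc k)) * poly (pderiv (binomial_poly (Suc k))) (0 :: 'a)"
    by (subst binomial_poly.simps(2), subst pderiv_mult)
      (simp add: pderiv_pCons poly_binomial_poly_0 del: of_nat_Suc binomial_poly.simps(2))
  then show ?case
    by (simp add: Suc del: of_nat_Suc binomial_poly.simps(2))
qed (simp add: pderiv_pCons)

lemma pderiv_sum: "pderiv (\<Sum>x\<in>A. f x) = (\<Sum>x\<in>A. pderiv (f x))"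
  by (induction A rule: infinite_finite_induct) (auto simp: pderiv_add)

text \<open>The binomial theorem, truncated at a bound independent of \<open>N\<close>, so that the
  right side is polynomial in \<open>N\<close>. The extra factor \<open>Z ^ j\<close> makes the
  induction on \<open>N\<close> go through.\<close>

lemma coeff_binomial_power:
  fixes Z :: "('v, 'k::field_char_0) ncps"
  assumes "coeff Z [] = 0"
  shows "coeff (Z ^ j * (1 + Z) ^ N) w =
    (\<Sum>k\<le>length w. of_nat (N choose k) * coeff (Z ^ (k + j)) w)"
proof (induction N arbitrary: j)
  case 0
  have "(\<Sum>k\<le>length w. of_nat (0 choose k) * coeff (Z ^ (k + j)) w) =
      (\<Sum>k\<le>length w. if k = 0 then coeff (Z ^ j) w else 0)"
    by (rule sum.cong) auto
  then show ?case by simp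
next
  case (Suc N)
  let ?G = "\<lambda>k. coeff (Z ^ k) w"
  have "Z ^ j * (1 + Z) ^ Suc N = Z ^ j * (1 + Z) ^ N + Z ^ Suc j * (1 + Z) ^ N"
    by (simp add: power_Suc2[of Z] algebra_simps del: power_Suc) (simp add: algebra_simps)
  then have "coeff (Z ^ j * (1 + Z) ^ Suc N) w =
      (\<Sum>k\<le>length w. of_nat (N choose k) * ?G (k + j)) +
      (\<Sum>k\<le>length w. of_nat (N choose k) * ?G (k + Suc j))"
    by (simp add: Suc del: power_Suc)
  \<comment> \<open>The top term contains a power of \<open>Z\<close> exceeding the length of
    \<open>w\<close>, hence vanishes.\<close>
  also have "(\<Sum>k\<le>length w. of_nat (N choose k) * ?G (k + Suc j)) =
      (\<Sum>k<length w. of_nat (N choose k) * ?G (k + Suc j))"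
    by (simp add: lessThan_Suc_atMost[symmetric] coeff_power_eq_0 assms del: power_Suc)
  also have "(\<Sum>k\<le>length w. of_nat (N choose k) * ?G (k + j)) =
      ?G j + (\<Sum>k<length w. of_nat (N choose Suc k) * ?G (k + Suc j))"
    by (simp add: sum.atMost_shift del: power_Suc)
  also have "?G j + (\<Sum>k<length w. of_nat (N choose Suc k) * ?G (k + Suc j)) +
      (\<Sum>k<length w. of_nat (N choose k) * ?G (k + Suc j)) =
      (\<Sum>k\<le>length w. of_nat (Suc N choose k) * ?G (k + j))"
    by (simp add: sum.atMost_shift sum.distrib algebra_simps del: power_Suc)
  finally show ?case .
qed

lemma coeff_nc_log:
  assumes "coeff A [] = 1"
  shows "coeff (nc_log A) w =
    (\<Sum>k<length w. (-1) ^ k / of_nat (Suc k) * coeff ((A - 1) ^ Suc k) w)"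
proof -
  have "coeff ((A - 1) ^ Suc k) w = 0" if "\<not> k < length w" for k
    using that assms by (intro coeff_power_eq_0) (auto simp: coeff_1)
  then show ?thesis
    unfolding nc_log_def nc_suminf_def coeff_Abs_ncps coeff_nc_scale
    by (intro Sum_any.expand_superset) (auto simp del: power_Suc)
qed

text \<open>The coefficient of \<open>A ^ N\<close> at a word is a polynomial in \<open>N\<close>, whose derivative
  at \<open>N = 0\<close> is the coefficient of \<open>log A\<close>; a product of two polynomials that vanish at \<open>0\<close>
  has derivative \<open>0\<close> there.\<close>

lemma shuffle_sum_nc_log:
  fixes A :: "('v, 'k::field_char_0) ncps"
  assumes "character (coeff A)" "coeff A [] = 1" "u \<noteq> []" "v \<noteq> []"
  shows "shuffle_sum (coeff (nc_log A)) u v = 0"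
proof -
  define p where "p w = (\<Sum>k\<le>length w. smult (coeff ((A - 1) ^ k) w) (binomial_poly k))" for w
  have Z: "coeff (A - 1) [] = 0"
    using assms by (simp add: coeff_1)
  have p: "poly (p w) (of_nat N) = coeff (A ^ N) w" for w N
    using coeff_binomial_power[OF Z, of 0 N w]
    by (simp add: p_def poly_sum poly_binomial_poly mult.commute)
  have p0: "poly (p w) 0 = 0" if "w \<noteq> []" for w
    using p[of w 0] that by (simp add: coeff_1)
  have p': "poly (pderiv (p w)) 0 = coeff (nc_log A) w" for w
    unfolding p_def coeff_nc_log[OF assms(2)]
    by (simp add: sum.atMost_shift pderiv_add pderiv_sum pderiv_smult poly_sum
        poly_pderiv_binomial_poly_Suc_0 mult.commute[of "coeff _ _"]
        del: power_Suc binomial_poly.simps(2) of_nat_Suc)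
  have "poly (shuffle_sum p u v) (of_nat N) = poly (p u * p v) (of_nat N)" for N
    using character_power[OF assms(1), of N]
    by (simp add: shuffle_sum_hom[where h = "\<lambda>q. poly q (of_nat N)", symmetric] p character_def)
  \<comment> \<open>In characteristic zero the naturals are infinitely many points, so agreement on
    them is equality of polynomials.\<close>
  then have "range of_nat \<subseteq> {x. poly (shuffle_sum p u v - p u * p v) x = 0}"
    by auto
  moreover have "infinite (range (of_nat :: nat \<Rightarrow> 'k))"
    by (simp add: finite_image_iff inj_of_nat)
  ultimately have "shuffle_sum p u v - p u * p v = 0"
    using poly_roots_finite finite_subset by blast
  then have "shuffle_sum p u v = p u * p v" by simp
  then have "poly (pderiv (shuffle_sum p u v)) 0 = 0"
    by (simp add: pderiv_mult p0 assms)
  then show ?thesis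
    by (simp add: shuffle_sum_hom[where h = "\<lambda>q. poly (pderiv q) 0", symmetric] pderiv_add p')
qed

section \<open>Sums of nested commutators\<close>

text \<open>Word form of \<open>nested_comm\<close>: sums over permutations become sums over
  \<open>permutations_of_set\<close>, which can be split by first letter.\<close>

definition right_nested :: "'v \<Rightarrow> 'v list \<Rightarrow> ('v, 'k::comm_ring_1) ncps" where
  "right_nested a xs = foldr (\<lambda>i. nc_comm (nc_var i)) xs (nc_var a)"

lemma right_nested_Cons: "right_nested a (x # xs) = nc_comm (nc_var x) (right_nested a xs)"
  by (simp add: right_nested_def)

lemma coeff_mult_nc_var:
  fixes B :: "('v, 'k::comm_ring_1) ncps"
  shows "coeff (B * nc_var i) w = (if w \<noteq> [] \<and> last w = i then coeff B (butlast w) else 0)"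
proof (cases w rule: rev_cases)
  case (snoc w' x)
  have "coeff (B * nc_var i) w = (\<Sum>j\<le>length w'. coeff B (take j w') * (if j = length w' \<and> x = i then 1 else 0))"
    unfolding coeff_mult snoc
    by (auto simp: coeff_nc_var intro!: sum.cong)
  also have "\<dots> = (\<Sum>j\<le>length w'. if j = length w' then (if x = i then coeff B w' else 0) else 0)"
    by (rule sum.cong) auto
  finally show ?thesis by (simp add: snoc)
qed (simp add: coeff_mult coeff_nc_var)

lemma coeff_nc_comm_nc_var:
  fixes B :: "('v, 'k::comm_ring_1) ncps"
  assumes "w \<noteq> []"
  shows "coeff (nc_comm (nc_var i) B) w =
    (if hd w = i then coeff B (tl w) else 0) - (if last w = i then coeff B (butlast w) else 0)"
  using assms by (auto simp: nc_comm_def coeff_nc_var_mult coeff_mult_nc_var split: list.split)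

text \<open>The nested bracket is multihomogeneous: each commutator adds one occurrence of its
  variable.\<close>

lemma coeff_right_nested_eq_0:
  assumes "mset w \<noteq> add_mset a (mset xs)"
  shows "coeff (right_nested a xs :: ('v, 'k::comm_ring_1) ncps) w = 0"
  using assms
proof (induction xs arbitrary: w)
  case (Cons x xs)
  show ?case
  proof (cases "w = []")
    case False
    have "mset (tl w) \<noteq> add_mset a (mset xs)" if "hd w = x"
      using False Cons.prems that by (cases w) auto
    moreover have "mset (butlast w) \<noteq> add_mset a (mset xs)" if "last w = x"
      using False Cons.prems that by (cases w rule: rev_cases) auto
    ultimately show ?thesis
      using Cons.IH False by (simp add: right_nested_Cons coeff_nc_comm_nc_var)
  qed (simp add: right_nested_Cons nc_comm_def coeff_mult coeff_nc_var)
qed (auto simp: right_nested_def coeff_nc_var)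

text \<open>Permutations are grouped by their first letter \<open>x\<close>, the outermost variable.
  A commutator with that variable reaches \<open>w\<close> only if \<open>x\<close> is its first
  letter or, with a minus sign, its last. The value 0 of \<open>T\<close> outside \<open>S\<close>
  covers an end letter equal to \<open>a\<close>.\<close>

lemma sum_right_nested_step:
  fixes c :: "'v list \<Rightarrow> 'k::comm_ring_1" and a :: 'v
  assumes "finite S" "S \<noteq> {}" "w \<noteq> []"
  defines "T \<equiv> \<lambda>x w'. if x \<in> S
    then \<Sum>xs\<in>permutations_of_set (S - {x}). c (x # xs) * coeff (right_nested a xs) w' else 0"
  shows "(\<Sum>xs\<in>permutations_of_set S. c xs * coeff (right_nested a xs) w) =
    T (hd w) (tl w) - T (last w) (butlast w)"
proof -
  have "(\<Sum>xs\<in>permutations_of_set S. c xs * coeff (right_nested a xs) w) =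
      (\<Sum>x\<in>S. \<Sum>xs\<in>(#) x ` permutations_of_set (S - {x}). c xs * coeff (right_nested a xs) w)"
    unfolding permutations_of_set_nonempty[OF assms(2)]
    by (rule sum.UNION_disjoint) (use assms in auto)
  also have "\<dots> = (\<Sum>x\<in>S. \<Sum>xs\<in>permutations_of_set (S - {x}). c (x # xs) *
      ((if hd w = x then coeff (right_nested a xs) (tl w) else 0) -
       (if last w = x then coeff (right_nested a xs) (butlast w) else 0)))"
    by (rule sum.cong) (simp_all add: sum.reindex right_nested_Cons coeff_nc_comm_nc_var assms(3))
  also have "\<dots> = (\<Sum>x\<in>S. (if hd w = x then T x (tl w) else 0) -
      (if last w = x then T x (butlast w) else 0))"
    by (intro sum.cong refl) (auto simp: T_def sum_subtractf right_diff_distrib)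
  also have "\<dots> = T (hd w) (tl w) - T (last w) (butlast w)"
    using assms(1) by (simp add: sum_subtractf) (simp add: T_def)
  finally show ?thesis .
qed

text \<open>With the right part of the word reversed, its last letter is the head of
  \<open>v\<close>. Peeling the outermost commutator therefore removes the head of \<open>u\<close>
  or, with a sign, the head of \<open>v\<close>, which is the recursion of
  \<open>shuffle_sum\<close>.\<close>

lemma coeff_sum_right_nested:
  fixes c :: "'v list \<Rightarrow> 'k::comm_ring_1"
  assumes "distinct (a # u @ v)"
  shows "(\<Sum>xs\<in>permutations_of_set (set u \<union> set v). c xs * coeff (right_nested a xs) (u @ a # rev v)) =
    (-1) ^ length v * shuffle_sum c u v"
  using assms
proof (induction c u v rule: shuffle_sum.induct)
  case (1 c v)
  show ?case
    using 1
  \<comment> \<open>The base cases of \<open>shuffle_sum\<close> supply no induction hypothesis, but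
    one nonempty side still has to be peeled letter by letter.\<close>
  proof (induction v arbitrary: c)
    case Nil
    then show ?case by (simp add: right_nested_def coeff_nc_var)
  next
    case (Cons b v)
    have "insert b (set v) - {b} = set v"
      using Cons.prems by auto
    then show ?case
      using Cons.prems Cons.IH[of "\<lambda>w. c (b # w)"]
      by (subst sum_right_nested_step) (simp_all add: butlast_append)
  qed
next
  case (2 c x u)
  show ?case
    using 2
  proof (induction "x # u" arbitrary: c x u)
    case (Cons x u)
    have "insert x (set u) - {x} = set u"
      using Cons.prems by auto
    moreover have "(\<Sum>xs\<in>permutations_of_set (set u). c (x # xs) * coeff (right_nested a xs) (u @ [a])) =
        c (x # u)"
    proof (cases u)
      case Nil
      then show ?thesis by (simp add: right_nested_def coeff_nc_var)
    next
      case (Cons y u')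
      then show ?thesis
        using Cons.hyps(1)[of y u' "\<lambda>w. c (x # w)"] Cons.prems by simp
    qed
    ultimately show ?case
      using Cons.prems by (subst sum_right_nested_step) simp_all
  qed
next
  case (3 c x u y v)
  have "insert x (set u \<union> insert y (set v)) - {x} = set u \<union> insert y (set v)"
    "insert x (set u \<union> insert y (set v)) - {y} = insert x (set u \<union> set v)"
    "insert y (insert x (set u \<union> set v)) - {x} = insert y (set u \<union> set v)"
    "insert y (insert x (set u \<union> set v)) - {y} = insert x (set u \<union> set v)"
    using 3 by auto
  then show ?case
    using 3 by (subst sum_right_nested_step) (simp_all add: butlast_append algebra_simps)
qed

section \<open>Coefficients at multilinear words\<close>

fun list_descents :: "'a::linorder list \<Rightarrow> nat" where
  "list_descents (a # b # w) = (if b < a then 1 else 0) + list_descents (b # w)"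
| "list_descents _ = 0"

lemma list_descents_le: "list_descents (a # w) \<le> length w"
proof (induction w arbitrary: a)
  case (Cons b w)
  then show ?case by (auto simp: le_SucI)
qed simp

lemma list_descents_snoc:
  "list_descents (w @ [a, b]) = list_descents (w @ [a]) + (if b < a then 1 else 0)"
proof (induction w)
  case (Cons c w)
  then show ?case by (cases w) auto
qed simp

lemma conv_cong:
  assumes "\<And>j. g (take j w) = g' (take j w)"
  shows "conv g h w = conv g' h w"
  by (simp add: conv_def assms)

text \<open>On words without repetition each exponential acts as 1 + X_i, so an increasing word
  arises exactly once, from the factors of its own letters.\<close>

lemma coeff_prod_list_nc_exp:
  fixes w :: "'v::linorder list"
  assumes "sorted_wrt (<) ns" "distinct w"
  shows "coeff (prod_list (map (\<lambda>i. nc_exp (nc_var i)) ns)) w =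
    (if sorted_wrt (<) w \<and> set w \<subseteq> set ns then 1 else (0 :: 'k::field_char_0))"
  using assms
proof (induction ns arbitrary: w)
  case (Cons i ns)
  let ?E = "coeff (nc_exp (nc_var i)) :: 'v list \<Rightarrow> 'k"
  let ?B = "coeff (prod_list (map (\<lambda>i. nc_exp (nc_var i)) ns)) :: 'v list \<Rightarrow> 'k"
  show ?case
  proof (cases w)
    case Nil
    then show ?thesis using Cons.IH[of "[]"] Cons.prems by (simp add: coeff_mult_conv coeff_nc_exp_nc_var)
  next
    case (Cons a t)
    have "conv (\<lambda>w. ?E (a # w)) ?B t = conv (\<lambda>w. if w = [] then (if a = i then 1 else 0) else 0) ?B t"
    proof (rule conv_cong)
      fix j
      have "distinct (a # take j t)"
        using Cons.prems Cons by (auto dest: in_set_takeD)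
      then show "?E (a # take j t) = (if take j t = [] then (if a = i then 1 else 0) else 0)"
        by (cases "take j t") (auto simp: coeff_nc_exp_nc_var)
    qed
    then show ?thesis
      using Cons.IH[of "a # t"] Cons.IH[of t] Cons.prems Cons
      by (auto simp: coeff_mult_conv conv_Cons conv_single coeff_nc_exp_nc_var)
        (metis insertE less_asym subsetD)
  qed
qed (auto simp: coeff_1)

text \<open>\<open>Z ^ Suc k\<close> counts the ways to cut the word into \<open>Suc k\<close> increasing blocks: every descent
  must be cut, and the other cuts are chosen among the ascents.\<close>

lemma coeff_power_increasing:
  fixes Z :: "('v::linorder, 'k::comm_ring_1) ncps"
  assumes Z: "\<And>w. distinct w \<Longrightarrow> set w \<subseteq> V \<Longrightarrow>
      coeff Z w = (if w \<noteq> [] \<and> sorted_wrt (<) w then 1 else 0)"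
    and "distinct (a # w)" "set (a # w) \<subseteq> V"
  shows "coeff (Z ^ Suc k) (a # w) = (if list_descents (a # w) \<le> k
    then of_nat ((length w - list_descents (a # w)) choose (k - list_descents (a # w))) else 0)"
  using assms(2,3)
proof (induction w arbitrary: a k)
  case Nil
  then show ?case
    using Z[of "[]"] Z[of "[a]"]
    by (cases k) (simp_all add: coeff_mult_conv conv_Cons coeff_1)
next
  case (Cons b t)
  have Z0: "coeff Z [] = 0" using Z[of "[]"] by simp
  have "conv (\<lambda>w. coeff Z (a # b # w)) (coeff (Z ^ k)) t =
      conv (\<lambda>w. (if a < b then 1 else 0) * coeff Z (b # w)) (coeff (Z ^ k)) t"
  proof (rule conv_cong)
    fix j
    have "distinct (a # b # take j t)" "set (a # b # take j t) \<subseteq> V"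
      using Cons.prems by (auto dest: in_set_takeD)
    then show "coeff Z (a # b # take j t) = (if a < b then 1 else 0) * coeff Z (b # take j t)"
      by (subst (1 2) Z) auto
  qed
  also have "\<dots> = (if a < b then 1 else 0) * coeff (Z ^ Suc k) (b # t)"
    by (simp add: coeff_mult_conv conv_Cons Z0) (simp add: conv_def)
  \<comment> \<open>Either \<open>a\<close> is a block of its own, or it is prepended to the first
    block of \<open>b # t\<close>, which requires an ascent.\<close>
  finally have *: "coeff (Z ^ Suc k) (a # b # t) =
      coeff (Z ^ k) (b # t) + (if a < b then 1 else 0) * coeff (Z ^ Suc k) (b # t)"
    using Z[of "[a]"] Cons.prems by (simp add: coeff_mult_conv[of Z] conv_Cons Z0)
  have IH: "coeff (Z ^ Suc k) (b # t) = (if list_descents (b # t) \<le> k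
      then of_nat ((length t - list_descents (b # t)) choose (k - list_descents (b # t))) else 0)" for k
    using Cons by simp
  have le: "list_descents (b # t) \<le> length t" by (rule list_descents_le)
  have "a < b \<or> b < a" using Cons.prems by auto
  then show ?case
  proof
    assume "b < a"
    then have "\<not> a < b" by simp
    with \<open>b < a\<close> show ?thesis
      unfolding * by (cases k) (simp_all add: IH coeff_1 del: power_Suc)
  next
    \<comment> \<open>Here the recursion is Pascal's rule. For \<open>k = 0\<close> the first
      summand comes from \<open>Z ^ 0 = 1\<close> and is 0 at a nonempty word.\<close>
    assume ab: "a < b"
    then have "\<not> b < a" by simp
    then show ?thesis
      unfolding * IH using ab le
      by (cases k) (auto simp add: IH coeff_1 Suc_diff_le le_Suc_eq simp del: power_Suc)
  qed
qed

text \<open>Both sides are the integral of x^d (1-x)^a over [0,1]. The induction is x^d (1-x)^(a+1)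
  = x^d (1-x)^a - x^(d+1) (1-x)^a, in coefficients.\<close>

lemma alternating_binomial_sum:
  "(\<Sum>j\<le>a. (-1) ^ j * of_nat (a choose j) / of_nat (Suc (d + j))) =
    (fact d * fact a / fact (Suc (d + a)) :: 'k::field_char_0)"
proof (induction a arbitrary: d)
  case 0
  then show ?case by (simp del: of_nat_Suc)
next
  case (Suc a)
  let ?f = "\<lambda>a d j. (-1) ^ j * of_nat (a choose j) / of_nat (Suc (d + j)) :: 'k"
  have "?f (Suc a) d (Suc j) = ?f a d (Suc j) - ?f a (Suc d) j" for j
    by (simp add: ring_distribs diff_divide_distrib del: of_nat_Suc)
  then have "(\<Sum>j\<le>Suc a. ?f (Suc a) d j) =
      ?f a d 0 + (\<Sum>j\<le>a. ?f a d (Suc j)) - (\<Sum>j\<le>a. ?f a (Suc d) j)"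
    unfolding sum.atMost_Suc_shift by (simp add: sum_subtractf)
  also have "?f a d 0 + (\<Sum>j\<le>a. ?f a d (Suc j)) = (\<Sum>j\<le>Suc a. ?f a d j)"
    by (subst sum.atMost_Suc_shift) simp
  also have "\<dots> = (\<Sum>j\<le>a. ?f a d j)" by simp
  also have "\<dots> - (\<Sum>j\<le>a. ?f a (Suc d) j) =
      fact d * fact a / fact (Suc (d + a)) - fact (Suc d) * fact a / fact (Suc (Suc d + a))"
    by (simp only: Suc)
  also have "\<dots> = fact d * fact (Suc a) / fact (Suc (d + Suc a))"
    by (simp add: divide_simps del: of_nat_Suc) (simp add: algebra_simps)
  finally show ?case .
qed

lemma coeff_nc_log_increasing:
  fixes A :: "('v::linorder, 'k::field_char_0) ncps"
  assumes A: "\<And>w. distinct w \<Longrightarrow> set w \<subseteq> V \<Longrightarrow> coeff A w = (if sorted_wrt (<) w then 1 else 0)"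
    and w: "distinct (a # w)" "set (a # w) \<subseteq> V"
  defines "d \<equiv> list_descents (a # w)"
  shows "coeff (nc_log A) (a # w) =
    (-1) ^ d / (of_nat (Suc (length w)) * of_nat (length w choose d))"
proof -
  define e where "e = length w - d"
  have l: "length w = d + e"
    using list_descents_le[of a w] by (simp add: d_def e_def)
  have A0: "coeff A [] = 1" using A[of "[]"] by simp
  have "coeff (A - 1) w = (if w \<noteq> [] \<and> sorted_wrt (<) w then 1 else 0)"
    if "distinct w" "set w \<subseteq> V" for w
    using A[OF that] by (auto simp: coeff_1)
  note P = coeff_power_increasing[OF this w, folded d_def]
  have "coeff (nc_log A) (a # w) = (\<Sum>k<Suc (d + e). (-1) ^ k / of_nat (Suc k) *
      (if d \<le> k then of_nat (e choose (k - d)) else 0))"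
    by (simp only: coeff_nc_log[OF A0] P[folded e_def] length_Cons l)
  \<comment> \<open>The \<open>d\<close> descents are forced cuts; next, \<open>k = d + j\<close>
    with \<open>j\<close> further cuts among the \<open>e\<close> ascents.\<close>
  also have "\<dots> = (\<Sum>k\<in>{d..d + e}. (-1) ^ k / of_nat (Suc k) * of_nat (e choose (k - d)))"
    by (rule sum.mono_neutral_cong_right) auto
  also have "\<dots> = (\<Sum>j\<le>e. (-1) ^ (d + j) / of_nat (Suc (d + j)) * of_nat (e choose j))"
    by (rule sum.reindex_bij_witness[where i = "\<lambda>j. d + j" and j = "\<lambda>k. k - d"]) auto
  also have "\<dots> = (-1) ^ d * (\<Sum>j\<le>e. (-1) ^ j * of_nat (e choose j) / of_nat (Suc (d + j)))"
    by (simp add: sum_distrib_left power_add mult.assoc)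
  also have "\<dots> = (-1) ^ d * (fact d * fact e / fact (Suc (d + e)))"
    by (simp only: alternating_binomial_sum)
  also have "\<dots> = (-1) ^ d / (of_nat (Suc (length w)) * of_nat (length w choose d))"
    using binomial_fact[of d "length w", where 'a = 'k]
    by (simp add: l)
  finally show ?thesis .
qed

section \<open>From permutations to words\<close>

text \<open>Appending a letter larger than all the others creates no descent, so the word of length
  k+1 keeps the descent number of the permutation of k letters.\<close>

lemma list_descents_map_snoc:
  assumes "\<forall>i\<in>{1..k}. \<sigma> i < n"
  shows "list_descents (map \<sigma> [1..<Suc k] @ [n]) = descents k \<sigma>"
proof -
  have "list_descents (map \<sigma> [1..<Suc k]) = descents k \<sigma>" for k
  proof (induction k)
    case 0
    then show ?case by (simp add: descents_def)
  next
    case (Suc k)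
    show ?case
    proof (cases k)
      case (Suc k')
      have "{i \<in> {1..<Suc k}. \<sigma> (Suc i) < \<sigma> i} =
          {i \<in> {1..<k}. \<sigma> (Suc i) < \<sigma> i} \<union> (if \<sigma> (Suc k) < \<sigma> k then {k} else {})"
        using Suc by (auto simp: less_Suc_eq)
      then have "descents (Suc k) \<sigma> = descents k \<sigma> + (if \<sigma> (Suc k) < \<sigma> k then 1 else 0)"
        by (simp add: descents_def card_insert_if)
      then show ?thesis
        using Suc.IH list_descents_snoc[of "map \<sigma> [1..<k]" "\<sigma> k" "\<sigma> (Suc k)"] Suc
        by simp
    qed (simp add: descents_def)
  qed
  note * = this
  show ?thesis
  proof (cases k)
    case (Suc k')
    then have "\<not> n < \<sigma> k" using assms[rule_format, of k] by simp
    moreover have "map \<sigma> [1..<Suc k] = map \<sigma> [1..<k] @ [\<sigma> k]" using Suc by simp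
    ultimately show ?thesis
      using list_descents_snoc[of "map \<sigma> [1..<k]" "\<sigma> k" n] *[of k] by (simp del: upt_Suc)
  qed (simp add: descents_def)
qed

lemma bij_betw_permutes_permutations_of_set:
  "bij_betw (\<lambda>\<sigma>. map \<sigma> [1..<Suc k]) {\<sigma>. \<sigma> permutes {1..k}} (permutations_of_set {1..k})"
proof -
  let ?F = "\<lambda>\<sigma>. map \<sigma> [1..<Suc k]"
  have inj: "inj_on ?F {\<sigma>. \<sigma> permutes {1..k}}"
  proof (rule inj_onI)
    fix \<sigma> \<tau> assume *: "\<sigma> \<in> {\<sigma>. \<sigma> permutes {1..k}}" "\<tau> \<in> {\<sigma>. \<sigma> permutes {1..k}}" "?F \<sigma> = ?F \<tau>"
    show "\<sigma> = \<tau>"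
    proof
      fix i
      show "\<sigma> i = \<tau> i"
      proof (cases "i \<in> {1..k}")
        case True
        then show ?thesis using *(3) by (auto simp del: upt_Suc)
      next
        case False
        then show ?thesis using * permutes_not_in by (metis mem_Collect_eq)
      qed
    qed
  qed
  have sub: "?F ` {\<sigma>. \<sigma> permutes {1..k}} \<subseteq> permutations_of_set {1..k}"
  proof clarify
    fix \<sigma> assume \<sigma>: "\<sigma> permutes {1..k}"
    have "set [1..<Suc k] = {1..k}" by auto
    then show "?F \<sigma> \<in> permutations_of_set {1..k}"
      using permutes_image[OF \<sigma>] permutes_inj_on[OF \<sigma>]
      by (auto simp: permutations_of_set_def distinct_map simp del: upt_Suc)
  qed
  have "?F ` {\<sigma>. \<sigma> permutes {1..k}} = permutations_of_set {1..k}"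
    \<comment> \<open>Surjectivity by counting: both sets have k! elements.\<close>
    by (rule card_subset_eq[OF _ sub])
       (simp_all add: card_image[OF inj] card_permutations[OF refl] del: upt_Suc One_nat_def)
  with inj show ?thesis by (simp add: bij_betw_def)
qed

lemma coeff_ncps_sum: "coeff (\<Sum>x\<in>S. f x) w = (\<Sum>x\<in>S. coeff (f x) w)"
  by (induction S rule: infinite_finite_induct) auto

theorem mainTheorem1:
  fixes n :: nat
  assumes "n \<ge> 2"
  shows "(phi n :: (nat, 'k::field_char_0) ncps) =
    nc_scale (1 / of_nat n)
      (\<Sum>\<sigma> | \<sigma> permutes {1..n-1}.
        nc_scale ((-1) ^ descents (n-1) \<sigma> * (1 / of_nat ((n-1) choose descents (n-1) \<sigma>)))
          (nested_comm n \<sigma>))"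
proof (rule ncps_eqI)
  fix w
  obtain m where n: "n = Suc m" using assms by (cases n) auto
  define A :: "(nat, 'k) ncps" where "A = prod_list (map (\<lambda>i. nc_exp (nc_var i)) [1..<Suc n])"
  define f where "f = coeff (nc_log A)"
  let ?rhs = "nc_scale (1 / of_nat n)
      (\<Sum>\<sigma> | \<sigma> permutes {1..n-1}.
        nc_scale ((-1) ^ descents (n-1) \<sigma> * (1 / of_nat ((n-1) choose descents (n-1) \<sigma>)))
          (nested_comm n \<sigma>)) :: (nat, 'k) ncps"
  have A: "coeff A w = (if sorted_wrt (<) w then 1 else 0)" if "distinct w" "set w \<subseteq> {1..n}" for w
    unfolding A_def using that
    by (subst coeff_prod_list_nc_exp) (auto simp del: upt_Suc)
  have "character (coeff A)"
    unfolding A_def by (rule character_prod_list) (auto intro: character_nc_exp_nc_var)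
  then have shuffle: "shuffle_sum f u v = 0" if "u \<noteq> []" "v \<noteq> []" for u v
    unfolding f_def using that A[of "[]"] by (intro shuffle_sum_nc_log) auto
  \<comment> \<open>The scalars of the theorem are values of \<open>f\<close>; the prefactor 1/n
    comes from the word having n = m + 1 letters.\<close>
  have f: "f (map \<sigma> [1..<Suc m] @ [n]) =
      1 / of_nat n * ((-1) ^ descents m \<sigma> * (1 / of_nat (m choose descents m \<sigma>)))"
    if "\<sigma> permutes {1..m}" for \<sigma>
  proof -
    define xs where "xs = map \<sigma> [1..<Suc m] @ [n]"
    have "map \<sigma> [1..<Suc m] \<in> permutations_of_set {1..m}"
      using bij_betwE[OF bij_betw_permutes_permutations_of_set, of m] that by blast
    then have xs: "distinct xs" "set xs \<subseteq> {1..n}" "length xs = Suc m"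
      by (auto simp: xs_def n permutations_of_set_def simp del: upt_Suc)
    then obtain a w where aw: "xs = a # w" by (cases xs) auto
    have "\<sigma> i < n" if "i \<in> {1..m}" for i
      using permutes_in_image[OF \<open>\<sigma> permutes {1..m}\<close>, of i] that by (simp add: n)
    then have "\<forall>i\<in>{1..m}. \<sigma> i < n" ..
    then have d: "list_descents xs = descents m \<sigma>"
      unfolding xs_def by (rule list_descents_map_snoc)
    have "f xs = (-1) ^ descents m \<sigma> / (of_nat (Suc (length w)) * of_nat (length w choose descents m \<sigma>))"
      unfolding f_def aw d[unfolded aw, symmetric]
      by (rule coeff_nc_log_increasing[OF A]) (use xs in \<open>auto simp: aw\<close>)
    moreover have "length w = m" using xs(3) by (simp add: aw)
    ultimately show ?thesis
      unfolding xs_def[symmetric] by (simp add: n)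
  qed
  have "coeff ?rhs w = (\<Sum>\<sigma> | \<sigma> permutes {1..m}.
      f (map \<sigma> [1..<Suc m] @ [n]) * coeff (right_nested n (map \<sigma> [1..<Suc m])) w)"
    unfolding coeff_nc_scale coeff_ncps_sum sum_distrib_left
    by (rule sum.cong)
       (simp_all add: n f[unfolded n] nested_comm_def right_nested_def foldr_map comp_def
         del: upt_Suc of_nat_Suc One_nat_def)
  also have "\<dots> = (\<Sum>xs\<in>permutations_of_set {1..m}. f (xs @ [n]) * coeff (right_nested n xs) w)"
    by (rule sum.reindex_bij_betw[OF bij_betw_permutes_permutations_of_set])
  finally have rhs: "coeff ?rhs w =
      (\<Sum>xs\<in>permutations_of_set {1..m}. f (xs @ [n]) * coeff (right_nested n xs) w)" .
  show "coeff (phi n) w = coeff ?rhs w"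
  proof (cases "length w = n \<and> (\<forall>i\<in>{1..n}. count_list w i = 1)")
    case True
    \<comment> \<open>Length \<open>n\<close> together with all counts equal to 1 makes
      \<open>w\<close> an arrangement of 1, ..., n.\<close>
    then have sub: "{1..n} \<subseteq> set w"
      by (metis count_notin zero_neq_one subsetI)
    moreover have "card (set w) \<le> n" using True card_length by blast
    ultimately have set: "set w = {1..n}"
      by (metis card_atLeastAtMost card_seteq diff_Suc_1 finite_set)
    then have dist: "distinct w"
      using True by (simp add: card_distinct)
    obtain u v where w: "w = u @ n # v"
      using set split_list[of n w] n by auto
    have uv: "set u \<union> set (rev v) = {1..m}"
    proof -
      have "set u \<union> set (rev v) = set w - {n}" using dist by (auto simp: w)
      also have "\<dots> = {1..m}" by (auto simp: set n)
      finally show ?thesis .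
    qed
    \<comment> \<open>The bracket side and the vanishing of \<open>f\<close> on shuffles give the
      same signed shuffle sum over \<open>u\<close> and \<open>rev v\<close>.\<close>
    have "coeff ?rhs w = (-1) ^ length (rev v) * shuffle_sum (\<lambda>xs. f (xs @ [n])) u (rev v)"
      unfolding rhs uv[symmetric] using dist coeff_sum_right_nested[of n u "rev v"]
      by (simp add: w)
    also have "\<dots> = f w"
      unfolding w using shuffle_sum_zero_imp_reverse[of f u n v] shuffle by simp
    also have "\<dots> = coeff (phi n) w"
      using True by (simp add: phi_def multilinear_part_def homogeneous_part_def Phi_def f_def A_def)
    finally show ?thesis by simp
  next
    case False
    \<comment> \<open>For any other word both sides vanish: the brackets live on words using each of
      1, ..., n exactly once.\<close>
    have "coeff (right_nested n xs :: (nat, 'k) ncps) w = 0" if "xs \<in> permutations_of_set {1..m}" for xs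
    proof (rule coeff_right_nested_eq_0)
      show "mset w \<noteq> add_mset n (mset xs)"
      proof
        assume eq: "mset w = add_mset n (mset xs)"
        have "mset w = mset_set {1..n}"
          using that eq by (simp add: n permutations_of_set_altdef permutations_of_multiset_def
              atLeastAtMostSuc_conv)
        then have "length w = n" "\<forall>i\<in>{1..n}. count_list w i = 1"
          by (auto simp flip: size_mset count_mset)
        with False show False by blast
      qed
    qed
    then have "coeff ?rhs w = 0"
      unfolding rhs by simp
    moreover have "coeff (phi n :: (nat, 'k) ncps) w = 0"
      using False by (auto simp: phi_def multilinear_part_def homogeneous_part_def)
    ultimately show ?thesis by (simp only:)
  qed
qed

end
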